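(* Let $\mathcal{G}$ be an undirected, connected graph of order $n$. Let $S=\{s\}$ be a set of one noise-corrupted leader ($0<k<\infty$) with information centrality $c_s$. Then the total system error of the leader-follower dynamics $d\mathbf{x}=-M\mathbf{x}\,dt+\sigma\,d\mathbf{W}$ is $$\sum_{i=1}^n\Sigma_{i,i}=\frac{n\sigma^2}{2}\left(\frac1k+\frac1{c_s}\right).$$ If instead the leader set $S$ is noise-free, then the total system error is $$\sum_{i=1}^n\Sigma_{i,i}=\frac{n\sigma^2}{2}\left(\frac1{c_s}\right).$$ In both the noise-corrupted and the noise-free cases, the optimal leader set (among single-node leader sets) is $S^*=\{s^*\}=\arg\max_s c_s$, the node with maximal information centrality $c_{s^*}$.
   Context: Setting. $\mathcal{G}$ is an undirected connected graph on nodes $\{1,\dots,n\}$ with symmetric adjacency matrix $A$ ($a_{i,j}=a_{j,i}>0$ if $(i,j)$ is an edge, $a_{i,j}=0$ otherwise), $D$ is the diagonal matrix with $d_{i,i}=\sum_j a_{i,j}$, and $L=D-A$ is the Laplacian. $L^+$ denotes the Moore-Penrose pseudoinverse of $L$. The number of leaders is less than $n$, so $n\ge 2$. Dynamics and error. Let $S$ be a nonempty set of nodes (leaders; here $S=\{s\}$), $k>0$, and $K$ the diagonal matrix with $K_{i,i}=k$ for $i\in S$ and $K_{i,i}=0$ otherwise; $M=L+K$. For $\sigma>0$ the dynamics are $d\mathbf{x}=-M\mathbf{x}\,dt+\sigma\,d\mathbf{W}$, with $\mathbf{W}$ a vector of $n$ independent standard Wiener processes. $\Sigma$ is the steady-state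 covariance matrix of $\mathbf{x}$, i.e. the solution of $M\Sigma+\Sigma M^T=\sigma^2 I$. The total system error is $\mathrm{tr}(\Sigma)=\sum_{i=1}^n\Sigma_{i,i}=\frac{\sigma^2}{2}\sum_{i=1}^n (M^{-1})_{i,i}$. The leaders are called noise-corrupted if $0<k<\infty$; for noise-free leaders the total system error means the limit of this quantity as $k\to\infty$. For given $m$ (here $m=1$), an optimal leader set is a set of $m$ nodes minimizing the total system error over all sets of $m$ nodes. Information centrality. The information centrality of node $i$ is $c_i=\left(\frac1n\sum_{j=1}^n r_{i,j}\right)^{-1}$, where $r_{i,j}=L^+_{i,i}+L^+_{j,j}-2L^+_{i,j}$ (the resistance distance, equal to the reciprocal of the total information between $i$ and $j$). *)

theory Defs
  imports "HOL-Analysis.Analysis"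
begin

(* E is the set of ordered pairs (i, j) such that {i, j} is an edge. Self-loops are not
   excluded; they cancel in the Laplacian. *)
definition undirected_weighted_graph :: "('n::finite \<times> 'n) set \<Rightarrow> real^'n^'n \<Rightarrow> bool" where
  "undirected_weighted_graph E A \<longleftrightarrow>
     sym E \<and>
     (\<forall>i j. A $ i $ j = A $ j $ i) \<and>
     (\<forall>i j. ((i, j) \<in> E \<longrightarrow> A $ i $ j > 0) \<and> ((i, j) \<notin> E \<longrightarrow> A $ i $ j = 0))"

definition connected_graph :: "('n \<times> 'n) set \<Rightarrow> bool" where
  "connected_graph E \<longleftrightarrow> (\<forall>i j. (i, j) \<in> E\<^sup>*)"

definition degree_matrix :: "real^'n^'n \<Rightarrow> real^'n^'n" where
  "degree_matrix A = (\<chi> i j. if i = j then (\<Sum>l\<in>UNIV. A $ i $ l) else 0)"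

definition laplacian :: "real^'n^'n \<Rightarrow> real^'n^'n" where
  "laplacian A = degree_matrix A - A"

(* The four Penrose equations, which determine X uniquely. *)
definition is_moore_penrose_inverse :: "real^'n^'m \<Rightarrow> real^'m^'n \<Rightarrow> bool" where
  "is_moore_penrose_inverse B X \<longleftrightarrow>
     B ** X ** B = B \<and>
     X ** B ** X = X \<and>
     transpose (B ** X) = B ** X \<and>
     transpose (X ** B) = X ** B"

definition pinv :: "real^'n^'m \<Rightarrow> real^'m^'n" where
  "pinv B = (THE X. is_moore_penrose_inverse B X)"

definition resistance_distance :: "real^'n^'n \<Rightarrow> 'n \<Rightarrow> 'n \<Rightarrow> real" where
  "resistance_distance A i j =
     (let P = pinv (laplacian A) in P $ i $ i + P $ j $ j - 2 * P $ i $ j)"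

definition information_centrality :: "real^'n^'n \<Rightarrow> 'n \<Rightarrow> real" where
  "information_centrality A i =
     inverse ((1 / real CARD('n)) * (\<Sum>j\<in>UNIV. resistance_distance A i j))"

definition leader_matrix :: "'n set \<Rightarrow> real \<Rightarrow> real^'n^'n" where
  "leader_matrix S k = (\<chi> i j. if i = j \<and> i \<in> S then k else 0)"

definition drift_matrix :: "real^'n^'n \<Rightarrow> 'n set \<Rightarrow> real \<Rightarrow> real^'n^'n" where
  "drift_matrix A S k = laplacian A + leader_matrix S k"

(* Lyapunov equation of dx = -M x dt + sigma dW, with W a vector of independent standard Wiener
   processes; mat c is c times the identity. *)
definition is_steady_state_covariance :: "real^'n^'n \<Rightarrow> real \<Rightarrow> real^'n^'n \<Rightarrow> bool" where
  "is_steady_state_covariance M \<sigma> \<Sigma> \<longleftrightarrow> M ** \<Sigma> + \<Sigma> ** transpose M = mat (\<sigma>\<^sup>2)"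

definition steady_state_covariance :: "real^'n^'n \<Rightarrow> real \<Rightarrow> real^'n^'n" where
  "steady_state_covariance M \<sigma> = (THE \<Sigma>. is_steady_state_covariance M \<sigma> \<Sigma>)"

definition total_error :: "real^'n^'n \<Rightarrow> real \<Rightarrow> real \<Rightarrow> 'n set \<Rightarrow> real" where
  "total_error A \<sigma> k S = trace (steady_state_covariance (drift_matrix A S k) \<sigma>)"

definition noise_free_total_error :: "real^'n^'n \<Rightarrow> real \<Rightarrow> 'n set \<Rightarrow> real" where
  "noise_free_total_error A \<sigma> S = Lim at_top (\<lambda>k. total_error A \<sigma> k S)"

definition optimal_leader_set :: "('n set \<Rightarrow> real) \<Rightarrow> nat \<Rightarrow> 'n set \<Rightarrow> bool" where
  "optimal_leader_set err m S \<longleftrightarrow> is_arg_min err (\<lambda>T. card T = m) S"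

end

theory Submission
  imports Defs
begin

text \<open>
  Write \<open>P\<close> for the pseudoinverse of the Laplacian \<open>L\<close>, \<open>J\<close> for the matrix with all entries
  \<open>1/n\<close>, and \<open>M = L + k e\<^sub>s e\<^sub>s\<^sup>T\<close> for the drift matrix of a single leader \<open>s\<close>. The result comes
  from an explicit inverse of \<open>M\<close>.

  Since the graph is connected, the kernel of \<open>L\<close> consists of the constant vectors, so \<open>L P = I - J\<close>
  is the orthogonal projection onto the vectors of sum zero (\<open>laplacian_mult_pinv\<close>). This identity
  makes the matrix \<open>G\<close> with entries \<open>1/k + P\<^sub>i\<^sub>j - P\<^sub>i\<^sub>s - P\<^sub>s\<^sub>j + P\<^sub>s\<^sub>s\<close> a right inverse of \<open>M\<close>
  (\<open>drift_matrix_mult_grounded_inverse\<close>). Its diagonal entries are \<open>1/k\<close> plus the resistance distance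
  from \<open>s\<close> to \<open>i\<close>, and the resistance distances from \<open>s\<close> sum to \<open>n / c\<^sub>s\<close>; hence
  \<open>tr G = n (1/k + 1/c\<^sub>s)\<close>.

  As \<open>M\<close> is symmetric, \<open>(\<sigma>\<^sup>2/2) G\<close> solves the Lyapunov equation, and as \<open>M\<close> is positive
  definite, it is the only solution (\<open>lyapunov_homogeneous_zero\<close>). This gives the error for finite
  \<open>k\<close>, and the noise-free error is its limit. Both are of the form \<open>a (b + 1/c\<^sub>s)\<close> with \<open>a > 0\<close> and
  with \<open>b\<close> independent of \<open>s\<close>, so minimizing the error is maximizing \<open>c\<^sub>s\<close>, provided that
  all \<open>c\<^sub>s\<close> are positive. That holds because distinct nodes have positive resistance distance
  (\<open>resistance_distance_pos\<close>) and there are at least two nodes.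
\<close>
section \<open>Uniqueness of the pseudoinverse\<close>

lemma matrix_add_rdistrib: "(B + C) ** X = B ** X + C ** X"
  by (simp add: matrix_matrix_mult_def vec_eq_iff distrib_right sum.distrib)

lemma matrix_sub_rdistrib:
  fixes B C :: "'a::ring_1 ^ 'n ^ 'm"
  shows "(B - C) ** X = B ** X - C ** X"
  by (simp add: matrix_matrix_mult_def vec_eq_iff left_diff_distrib sum_subtractf)

lemma matrix_sub_ldistrib:
  fixes B :: "'a::ring_1 ^ 'n ^ 'm"
  shows "B ** (X - Y) = B ** X - B ** Y"
  by (simp add: matrix_matrix_mult_def vec_eq_iff right_diff_distrib sum_subtractf)

text \<open>
  The symmetric idempotents \<open>B X\<close> and \<open>B Y\<close> are projections onto the same space, the range of \<open>B\<close>: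
  \<open>B X = B Y B X\<close>, whose transpose is \<open>B X B Y = B Y\<close>. Likewise \<open>X B = Y B\<close>, and then
  \<open>X = X B X = Y B Y = Y\<close>.
\<close>
lemma moore_penrose_inverse_unique:
  fixes B :: "real^'n^'m"
  assumes X: "is_moore_penrose_inverse B X" and Y: "is_moore_penrose_inverse B Y"
  shows "X = Y"
proof -
  have X1: "B ** X ** B = B" and X2: "X ** B ** X = X"
    and X3: "transpose (B ** X) = B ** X" and X4: "transpose (X ** B) = X ** B"
    using X by (auto simp: is_moore_penrose_inverse_def)
  have Y1: "B ** Y ** B = B" and Y2: "Y ** B ** Y = Y"
    and Y3: "transpose (B ** Y) = B ** Y" and Y4: "transpose (Y ** B) = Y ** B"
    using Y by (auto simp: is_moore_penrose_inverse_def)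
  have "B ** X = (B ** Y) ** (B ** X)"
    using Y1 by (simp add: matrix_mul_assoc)
  also have "\<dots> = transpose ((B ** X) ** (B ** Y))"
    by (simp add: matrix_transpose_mul[of "B ** X"] X3 Y3)
  also have "\<dots> = B ** Y"
    using X1 Y3 by (simp add: matrix_mul_assoc)
  finally have left: "B ** X = B ** Y" .
  have "X ** B = (X ** B) ** (Y ** B)"
    using Y1 by (metis matrix_mul_assoc)
  also have "\<dots> = transpose ((Y ** B) ** (X ** B))"
    by (simp add: matrix_transpose_mul[of "Y ** B"] X4 Y4)
  also have "\<dots> = Y ** B"
    using X1 Y4 by (metis matrix_mul_assoc)
  finally have right: "X ** B = Y ** B" .
  have "X = X ** (B ** X)"
    using X2 by (simp add: matrix_mul_assoc)
  also have "\<dots> = (Y ** B) ** Y"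
    by (simp add: left matrix_mul_assoc right)
  finally show "X = Y"
    using Y2 by simp
qed

lemma pinv_eqI:
  assumes "is_moore_penrose_inverse B X"
  shows "pinv B = X"
  unfolding pinv_def
  using assms by (blast intro: the_equality moore_penrose_inverse_unique)

section \<open>The Lyapunov equation of a positive definite matrix\<close>

definition positive_definite :: "real^'n^'n \<Rightarrow> bool" where
  "positive_definite M \<longleftrightarrow> transpose M = M \<and> (\<forall>x. x \<noteq> 0 \<longrightarrow> x \<bullet> (M *v x) > 0)"

lemma positive_definite_invertible:
  fixes M :: "real^'n^'n"
  assumes "positive_definite M"
  shows "invertible M"
proof -
  have "\<forall>x. M *v x = 0 \<longrightarrow> x = 0"
    using assms unfolding positive_definite_def by (metis inner_zero_right less_irrefl)
  then show ?thesis
    using invertible_left_inverse matrix_left_invertible_ker by blast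
qed

text \<open>
  Take the trace of \<open>Y\<^sup>T (M Y + Y M) = 0\<close>. The first summand is the sum of the quadratic form of \<open>M\<close>
  over the columns of \<open>Y\<close>, the second its sum over the rows, so all these nonnegative values vanish.
\<close>
lemma lyapunov_homogeneous_zero:
  fixes M Y :: "real^'n^'n"
  assumes pd: "positive_definite M" and eq: "M ** Y + Y ** M = 0"
  shows "Y = 0"
proof -
  have sym: "transpose M = M" and pos: "\<And>x. x \<noteq> 0 \<Longrightarrow> x \<bullet> (M *v x) > 0"
    using pd by (auto simp: positive_definite_def)
  have nonneg: "x \<bullet> (M *v x) \<ge> 0" for x
    using pos[of x] by (cases "x = 0") auto
  have col: "(\<Sum>i\<in>UNIV. Y $ i $ j * (M ** Y) $ i $ j) = column j Y \<bullet> (M *v column j Y)" for j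
    by (simp add: inner_vec_def column_def matrix_matrix_mult_def matrix_vector_mult_def)
  have row: "(\<Sum>j\<in>UNIV. Y $ i $ j * (Y ** M) $ i $ j) = row i Y \<bullet> (M *v row i Y)" for i
  proof -
    have "M $ l $ j = M $ j $ l" for l j
      using arg_cong[OF sym, of "\<lambda>B. B $ j $ l"] by (simp add: transpose_def)
    then show ?thesis
      by (simp add: inner_vec_def row_def matrix_matrix_mult_def matrix_vector_mult_def
          mult.commute)
  qed
  have "0 = (\<Sum>i\<in>UNIV. \<Sum>j\<in>UNIV. Y $ i $ j * (M ** Y + Y ** M) $ i $ j)"
    by (simp add: eq)
  also have "\<dots> = (\<Sum>i\<in>UNIV. \<Sum>j\<in>UNIV. Y $ i $ j * (M ** Y) $ i $ j)
      + (\<Sum>i\<in>UNIV. \<Sum>j\<in>UNIV. Y $ i $ j * (Y ** M) $ i $ j)"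
    by (simp add: distrib_left sum.distrib)
  also have "(\<Sum>i\<in>UNIV. \<Sum>j\<in>UNIV. Y $ i $ j * (M ** Y) $ i $ j)
      = (\<Sum>j\<in>UNIV. column j Y \<bullet> (M *v column j Y))"
    by (subst sum.swap) (simp only: col)
  also have "(\<Sum>i\<in>UNIV. \<Sum>j\<in>UNIV. Y $ i $ j * (Y ** M) $ i $ j)
      = (\<Sum>i\<in>UNIV. row i Y \<bullet> (M *v row i Y))"
    by (simp only: row)
  finally have total: "(\<Sum>j\<in>UNIV. column j Y \<bullet> (M *v column j Y))
      + (\<Sum>i\<in>UNIV. row i Y \<bullet> (M *v row i Y)) = 0"
    by simp
  have "(\<Sum>i\<in>UNIV. row i Y \<bullet> (M *v row i Y)) = 0"
    using total nonneg by (smt (verit) sum_nonneg)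
  then have "row i Y \<bullet> (M *v row i Y) = 0" for i
    using nonneg by (simp add: sum_nonneg_eq_0_iff)
  then have "row i Y = 0" for i
    using pos by (metis less_irrefl)
  then show ?thesis
    by (simp add: row_def vec_eq_iff)
qed

lemma steady_state_covariance_eq:
  fixes M G :: "real^'n^'n"
  assumes pd: "positive_definite M" and inv: "M ** G = mat 1"
  shows "steady_state_covariance M \<sigma> = (\<sigma>\<^sup>2 / 2) *\<^sub>R G"
proof -
  have sym: "transpose M = M"
    using pd by (simp add: positive_definite_def)
  have inv': "G ** M = mat 1"
    using inv matrix_left_right_inverse by blast
  have half: "(\<sigma>\<^sup>2 / 2) *\<^sub>R mat 1 + (\<sigma>\<^sup>2 / 2) *\<^sub>R mat 1 = (mat (\<sigma>\<^sup>2) :: real^'n^'n)"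
    by (simp add: mat_def vec_eq_iff)
  show ?thesis
    unfolding steady_state_covariance_def
  proof (rule the_equality)
    show sol: "is_steady_state_covariance M \<sigma> ((\<sigma>\<^sup>2 / 2) *\<^sub>R G)"
      by (simp add: is_steady_state_covariance_def sym matrix_scalar_ac
          scalar_matrix_assoc [symmetric] inv inv' half flip: scalar_mult_eq_scaleR)
    fix Z assume "is_steady_state_covariance M \<sigma> Z"
    then have "M ** (Z - (\<sigma>\<^sup>2 / 2) *\<^sub>R G) + (Z - (\<sigma>\<^sup>2 / 2) *\<^sub>R G) ** M = 0"
      using sol by (simp add: is_steady_state_covariance_def sym matrix_sub_ldistrib
          matrix_sub_rdistrib algebra_simps)
    then have "Z - (\<sigma>\<^sup>2 / 2) *\<^sub>R G = 0"
      by (rule lyapunov_homogeneous_zero[OF pd])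
    then show "Z = (\<sigma>\<^sup>2 / 2) *\<^sub>R G"
      by simp
  qed
qed

section \<open>The Laplacian of a connected graph and its pseudoinverse\<close>

text \<open>
  The orthogonal projection onto the constant vectors, that is, onto the kernel of the Laplacian of a
  connected graph.
\<close>
definition averaging_matrix :: "real^'n^'n" where
  "averaging_matrix = (\<chi> i j. 1 / real CARD('n))"

lemma averaging_matrix_mult_vec:
  "((averaging_matrix :: real^'n^'n) *v x) $ i = (\<Sum>j\<in>UNIV. x $ j) / real CARD('n)"
  by (simp add: averaging_matrix_def matrix_vector_mult_def sum_divide_distrib)

lemma transpose_averaging_matrix: "transpose averaging_matrix = averaging_matrix"
  by (simp add: averaging_matrix_def transpose_def)

lemma averaging_matrix_idem:
  "(averaging_matrix :: real^'n^'n) ** averaging_matrix = averaging_matrix"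
  by (simp add: averaging_matrix_def matrix_matrix_mult_def vec_eq_iff)

locale connected_weighted_graph =
  fixes E :: "('n::finite \<times> 'n) set" and A :: "real^'n^'n"
  assumes weighted: "undirected_weighted_graph E A"
    and connected: "connected_graph E"
begin

lemma adjacency_sym: "A $ i $ j = A $ j $ i"
  and adjacency_nonneg: "A $ i $ j \<ge> 0"
  and adjacency_pos: "(i, j) \<in> E \<Longrightarrow> A $ i $ j > 0"
  using weighted unfolding undirected_weighted_graph_def
  by (metis, metis less_eq_real_def, metis)

lemma laplacian_mult_vec:
  "(laplacian A *v x) $ i = (\<Sum>j\<in>UNIV. A $ i $ j * (x $ i - x $ j))"
proof -
  have "(laplacian A *v x) $ i
      = (\<Sum>j\<in>UNIV. (if i = j then (\<Sum>l\<in>UNIV. A $ i $ l) * x $ j else 0) - A $ i $ j * x $ j)"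
    unfolding laplacian_def degree_matrix_def matrix_vector_mult_def
    by (auto intro!: sum.cong simp: algebra_simps)
  also have "\<dots> = (\<Sum>l\<in>UNIV. A $ i $ l) * x $ i - (\<Sum>j\<in>UNIV. A $ i $ j * x $ j)"
    by (simp add: sum_subtractf)
  also have "\<dots> = (\<Sum>j\<in>UNIV. A $ i $ j * (x $ i - x $ j))"
    by (simp add: right_diff_distrib sum_subtractf sum_distrib_right)
  finally show ?thesis .
qed

lemma transpose_laplacian: "transpose (laplacian A) = laplacian A"
  unfolding laplacian_def degree_matrix_def transpose_def vec_eq_iff
  using adjacency_sym by simp

lemma laplacian_averaging: "laplacian A ** averaging_matrix = 0"
proof -
  have "(laplacian A ** averaging_matrix) *v x = 0" for x
    by (simp add: vec_eq_iff laplacian_mult_vec averaging_matrix_mult_vec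
        flip: matrix_vector_mul_assoc)
  then show ?thesis
    by (simp add: matrix_eq)
qed

lemma averaging_laplacian: "averaging_matrix ** laplacian A = 0"
proof -
  have "averaging_matrix ** laplacian A = transpose (laplacian A ** averaging_matrix)"
    by (simp add: matrix_transpose_mul transpose_laplacian transpose_averaging_matrix)
  then show ?thesis
    by (simp add: laplacian_averaging transpose_def vec_eq_iff)
qed

text \<open>
  Multiplying out gives the sum over all ordered pairs of \<open>A\<^sub>i\<^sub>j x\<^sub>i (x\<^sub>i - x\<^sub>j)\<close>. Adding the same sum with
  \<open>i\<close> and \<open>j\<close> exchanged completes the square and accounts for the factor \<open>1/2\<close>.
\<close>
lemma laplacian_quadratic_form:
  "x \<bullet> (laplacian A *v x) = (\<Sum>i\<in>UNIV. \<Sum>j\<in>UNIV. A $ i $ j * (x $ i - x $ j)\<^sup>2) / 2"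
proof -
  let ?q = "\<lambda>i j. A $ i $ j * (x $ i * (x $ i - x $ j))"
  have form: "x \<bullet> (laplacian A *v x) = (\<Sum>i\<in>UNIV. \<Sum>j\<in>UNIV. ?q i j)"
    by (simp add: inner_vec_def laplacian_mult_vec sum_distrib_left mult.left_commute)
  also have "\<dots> = (\<Sum>i\<in>UNIV. \<Sum>j\<in>UNIV. ?q j i)"
    by (rule sum.swap)
  finally have form': "x \<bullet> (laplacian A *v x) = (\<Sum>i\<in>UNIV. \<Sum>j\<in>UNIV. ?q j i)" .
  have "?q i j + ?q j i = A $ i $ j * (x $ i - x $ j)\<^sup>2" for i j
    by (subst adjacency_sym[of j i]) (simp add: power2_eq_square algebra_simps)
  then have "(\<Sum>i\<in>UNIV. \<Sum>j\<in>UNIV. ?q i j) + (\<Sum>i\<in>UNIV. \<Sum>j\<in>UNIV. ?q j i)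
      = (\<Sum>i\<in>UNIV. \<Sum>j\<in>UNIV. A $ i $ j * (x $ i - x $ j)\<^sup>2)"
    by (simp flip: sum.distrib)
  with form form' show ?thesis
    by simp
qed

lemma laplacian_nonneg: "x \<bullet> (laplacian A *v x) \<ge> 0"
  unfolding laplacian_quadratic_form
  by (intro divide_nonneg_nonneg sum_nonneg mult_nonneg_nonneg) (auto simp: adjacency_nonneg)

text \<open>
  If the sum of the terms \<open>A\<^sub>i\<^sub>j (x\<^sub>i - x\<^sub>j)\<^sup>2\<close> vanishes, then \<open>x\<close> agrees at the two ends of every edge, hence
  along every path. This is where connectedness enters.
\<close>
lemma laplacian_form_zero_imp_constant:
  assumes "x \<bullet> (laplacian A *v x) = 0"
  shows "x $ i = x $ j"
proof -
  have "A $ i $ j * (x $ i - x $ j)\<^sup>2 = 0" for i j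
    using assms adjacency_nonneg
    by (simp add: laplacian_quadratic_form sum_nonneg_eq_0_iff sum_nonneg)
  then have edge: "x $ i = x $ j" if "(i, j) \<in> E" for i j
    using adjacency_pos[OF that] by (metis eq_iff_diff_eq_0 less_irrefl mult_eq_0_iff
        zero_eq_power2)
  have "(i, j) \<in> E\<^sup>*"
    using connected by (simp add: connected_graph_def)
  then show ?thesis
    by (induction rule: rtrancl_induct) (auto dest: edge)
qed

text \<open>
  A vector on which both forms vanish is constant and has sum zero. Thus adding \<open>J\<close> repairs the
  kernel of \<open>L\<close> without disturbing \<open>L\<close> on its range.
\<close>
lemma positive_definite_laplacian_plus_averaging:
  "positive_definite (laplacian A + averaging_matrix)"
  unfolding positive_definite_def
proof (intro conjI allI impI)
  show "transpose (laplacian A + averaging_matrix) = laplacian A + averaging_matrix"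
    using transpose_laplacian transpose_averaging_matrix
    by (simp add: transpose_def vec_eq_iff)
  fix x :: "real^'n" assume "x \<noteq> 0"
  have form: "x \<bullet> ((laplacian A + averaging_matrix) *v x)
      = x \<bullet> (laplacian A *v x) + (\<Sum>i\<in>UNIV. x $ i)\<^sup>2 / real CARD('n)"
    by (simp add: matrix_vector_mult_add_rdistrib inner_add_right inner_vec_def[of x "_ *v _"]
        averaging_matrix_mult_vec power2_eq_square flip: sum_distrib_right sum_divide_distrib)
  moreover have "x \<bullet> ((laplacian A + averaging_matrix) *v x) \<noteq> 0"
  proof
    assume "x \<bullet> ((laplacian A + averaging_matrix) *v x) = 0"
    moreover have "(\<Sum>i\<in>UNIV. x $ i)\<^sup>2 / real CARD('n) \<ge> 0"
      by simp
    ultimately have zero: "x \<bullet> (laplacian A *v x) = 0" "(\<Sum>i\<in>UNIV. x $ i)\<^sup>2 / real CARD('n) = 0"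
      using form laplacian_nonneg[of x] by linarith+
    have "x $ i = 0" for i
    proof -
      have "(\<Sum>j\<in>UNIV. x $ j) = (\<Sum>j\<in>(UNIV::'n set). x $ i)"
        by (intro sum.cong laplacian_form_zero_imp_constant[OF zero(1)] refl)
      with zero(2) show ?thesis
        by simp
    qed
    with \<open>x \<noteq> 0\<close> show False
      by (simp add: vec_eq_iff)
  qed
  ultimately show "x \<bullet> ((laplacian A + averaging_matrix) *v x) > 0"
    using laplacian_nonneg[of x]
    by (smt (verit) divide_nonneg_nonneg of_nat_0_le_iff zero_le_power2)
qed

text \<open>
  The pseudoinverse is \<open>(L + J)\<^sup>-\<^sup>1 - J\<close>: the matrix \<open>L + J\<close> acts as \<open>L\<close> on the vectors of sum zero
  and as the identity on the constant vectors, and subtracting \<open>J\<close> from its inverse removes the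
  constant part again.
\<close>
lemma pinv_laplacian:
  shows laplacian_mult_pinv: "laplacian A ** pinv (laplacian A) = mat 1 - averaging_matrix"
    and transpose_pinv_laplacian: "transpose (pinv (laplacian A)) = pinv (laplacian A)"
    and pinv_laplacian_pinv:
      "pinv (laplacian A) ** laplacian A ** pinv (laplacian A) = pinv (laplacian A)"
proof -
  let ?L = "laplacian A" and ?J = "averaging_matrix :: real^'n^'n"
  obtain N where N: "(?L + ?J) ** N = mat 1" "N ** (?L + ?J) = mat 1"
    using positive_definite_invertible[OF positive_definite_laplacian_plus_averaging]
    unfolding invertible_def by blast
  define X where "X = N - ?J"
  have sum_sym: "transpose (?L + ?J) = ?L + ?J"
    using positive_definite_laplacian_plus_averaging by (simp add: positive_definite_def)
  have "(?L + ?J) ** transpose N = mat 1"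
    by (metis N(2) matrix_transpose_mul sum_sym transpose_mat)
  then have N_sym: "transpose N = N"
    by (metis N(2) matrix_mul_assoc matrix_mul_lid matrix_mul_rid)
  have J_fix: "(?L + ?J) ** ?J = ?J" "?J ** (?L + ?J) = ?J"
    by (simp_all add: matrix_add_rdistrib matrix_add_ldistrib laplacian_averaging
        averaging_laplacian averaging_matrix_idem)
  have NJ: "N ** ?J = ?J" and JN: "?J ** N = ?J"
    using J_fix N by (metis matrix_mul_assoc matrix_mul_lid, metis matrix_mul_assoc matrix_mul_rid)
  have LN: "?L ** N = mat 1 - ?J"
    using N(1) JN by (simp add: matrix_add_rdistrib eq_diff_eq)
  have NL: "N ** ?L = mat 1 - ?J"
    using N(2) NJ by (simp add: matrix_add_ldistrib eq_diff_eq)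
  have LX: "?L ** X = mat 1 - ?J"
    by (simp add: X_def matrix_sub_ldistrib LN laplacian_averaging)
  have XL: "X ** ?L = mat 1 - ?J"
    by (simp add: X_def matrix_sub_rdistrib NL averaging_laplacian)
  have X_sym: "transpose X = X"
    using N_sym transpose_averaging_matrix by (simp add: X_def transpose_def vec_eq_iff)
  have proj_sym: "transpose (mat 1 - ?J) = mat 1 - ?J"
    by (simp add: transpose_def averaging_matrix_def mat_def vec_eq_iff eq_commute)
  have XLX: "X ** ?L ** X = X"
    by (simp add: XL matrix_sub_rdistrib)
      (simp add: X_def matrix_sub_ldistrib JN averaging_matrix_idem)
  have "is_moore_penrose_inverse ?L X"
    unfolding is_moore_penrose_inverse_def
    by (simp add: LX XLX) (simp add: XL proj_sym matrix_sub_rdistrib averaging_laplacian)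
  then have "pinv ?L = X"
    by (rule pinv_eqI)
  with LX X_sym XLX show "?L ** pinv ?L = mat 1 - ?J" "transpose (pinv ?L) = pinv ?L"
    "pinv ?L ** ?L ** pinv ?L = pinv ?L"
    by simp_all
qed

lemma pinv_sym: "pinv (laplacian A) $ i $ j = pinv (laplacian A) $ j $ i"
  using arg_cong[OF transpose_pinv_laplacian, of "\<lambda>B. B $ j $ i"] by (simp add: transpose_def)

section \<open>The total error of a single leader\<close>

text \<open>
  On the kernel of \<open>L\<close>, the constant vectors, the leader term \<open>k x\<^sub>s\<^sup>2\<close> is positive unless the vector is
  zero.
\<close>
lemma positive_definite_drift_matrix:
  assumes "k > 0"
  shows "positive_definite (drift_matrix A {s} k)"
  unfolding positive_definite_def
proof (intro conjI allI impI)
  have "transpose (leader_matrix {s} k) = (leader_matrix {s} k :: real^'n^'n)"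
    by (auto simp: transpose_def leader_matrix_def vec_eq_iff)
  then show "transpose (drift_matrix A {s} k) = drift_matrix A {s} k"
    using transpose_laplacian by (simp add: drift_matrix_def transpose_def vec_eq_iff)
  fix x :: "real^'n" assume "x \<noteq> 0"
  have "leader_matrix {s} k *v x = axis s (k * x $ s)"
    by (simp add: vec_eq_iff axis_def leader_matrix_def matrix_vector_mult_def if_distrib if_distribR
        cong: if_cong)
  then have "x \<bullet> (leader_matrix {s} k *v x) = k * (x $ s)\<^sup>2"
    by (simp add: inner_axis power2_eq_square)
  then have form: "x \<bullet> (drift_matrix A {s} k *v x) = x \<bullet> (laplacian A *v x) + k * (x $ s)\<^sup>2"
    by (simp add: drift_matrix_def matrix_vector_mult_add_rdistrib inner_add_right)
  have leader_nonneg: "k * (x $ s)\<^sup>2 \<ge> 0"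
    using assms by simp
  have "\<not> (x \<bullet> (laplacian A *v x) = 0 \<and> k * (x $ s)\<^sup>2 = 0)"
  proof
    assume zero: "x \<bullet> (laplacian A *v x) = 0 \<and> k * (x $ s)\<^sup>2 = 0"
    then have "x $ i = 0" for i
      using laplacian_form_zero_imp_constant[of x i s] assms by simp
    with \<open>x \<noteq> 0\<close> show False
      by (simp add: vec_eq_iff)
  qed
  with form leader_nonneg laplacian_nonneg[of x] show "x \<bullet> (drift_matrix A {s} k *v x) > 0"
    by linarith
qed

text \<open>
  The inverse of the drift matrix \<open>L + k e\<^sub>s e\<^sub>s\<^sup>T\<close>. Without the term \<open>1/k\<close> it is the inverse of the
  grounded Laplacian (row and column \<open>s\<close> deleted), padded with zeros in row and column \<open>s\<close>.
\<close>
definition grounded_inverse :: "'n \<Rightarrow> real \<Rightarrow> real^'n^'n" where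
  "grounded_inverse s k =
     (let P = pinv (laplacian A)
      in (\<chi> i j. 1 / k + P $ i $ j - P $ i $ s - P $ s $ j + P $ s $ s))"

text \<open>
  Since \<open>L\<close> annihilates constant columns and \<open>L P = I - J\<close>, the product \<open>L G\<close> equals
  \<open>(I - J) - (e\<^sub>s 1\<^sup>T - J) = I - e\<^sub>s 1\<^sup>T\<close>. Row \<open>s\<close> of \<open>G\<close> is constantly \<open>1/k\<close>, so the leader term
  contributes the missing \<open>e\<^sub>s 1\<^sup>T\<close>.
\<close>
lemma drift_matrix_mult_grounded_inverse:
  assumes "k > 0"
  shows "drift_matrix A {s} k ** grounded_inverse s k = mat 1"
proof -
  let ?P = "pinv (laplacian A)"
  have LP: "(\<Sum>l\<in>UNIV. laplacian A $ i $ l * ?P $ l $ j)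
      = (if i = j then 1 else 0) - 1 / real CARD('n)" for i j
    using arg_cong[OF laplacian_mult_pinv, of "\<lambda>B. B $ i $ j"]
    by (simp add: matrix_matrix_mult_def mat_def averaging_matrix_def)
  have L1: "(\<Sum>l\<in>UNIV. laplacian A $ i $ l) = 0" for i
    using laplacian_mult_vec[of "\<chi> i. 1" i] by (simp add: matrix_vector_mult_def)
  have lap: "(laplacian A ** grounded_inverse s k) $ i $ j
      = (if i = j then 1 else 0) - (if i = s then 1 else 0)" for i j
  proof -
    have "(laplacian A ** grounded_inverse s k) $ i $ j
        = (\<Sum>l\<in>UNIV. laplacian A $ i $ l * ?P $ l $ j - laplacian A $ i $ l * ?P $ l $ s
          + laplacian A $ i $ l * (1 / k - ?P $ s $ j + ?P $ s $ s))"
      by (simp add: matrix_matrix_mult_def grounded_inverse_def Let_def)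
        (auto intro!: sum.cong simp: algebra_simps)
    also have "\<dots> = (\<Sum>l\<in>UNIV. laplacian A $ i $ l * ?P $ l $ j)
          - (\<Sum>l\<in>UNIV. laplacian A $ i $ l * ?P $ l $ s)
          + (\<Sum>l\<in>UNIV. laplacian A $ i $ l) * (1 / k - ?P $ s $ j + ?P $ s $ s)"
      by (simp only: sum.distrib sum_subtractf sum_distrib_right)
    finally show ?thesis
      by (simp add: LP L1)
  qed
  have leader: "(leader_matrix {s} k ** grounded_inverse s k) $ i $ j = (if i = s then 1 else 0)"
    for i j
    using assms
    by (simp add: matrix_matrix_mult_def leader_matrix_def grounded_inverse_def Let_def
        if_distrib if_distribR cong: if_cong)
  show ?thesis
    by (simp add: drift_matrix_def matrix_add_rdistrib vec_eq_iff lap leader mat_def)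
qed

lemma sum_resistance_distance:
  "(\<Sum>j\<in>UNIV. resistance_distance A s j) = real CARD('n) * (1 / information_centrality A s)"
  by (simp add: information_centrality_def)

lemma total_error_single_leader:
  assumes "k > 0"
  shows "total_error A \<sigma> k {s} =
    real CARD('n) * \<sigma>\<^sup>2 / 2 * (1 / k + 1 / information_centrality A s)"
proof -
  have "trace (grounded_inverse s k) = (\<Sum>j\<in>UNIV. 1 / k + resistance_distance A s j)"
    unfolding trace_def grounded_inverse_def resistance_distance_def Let_def
    by (intro sum.cong) (simp_all add: pinv_sym)
  also have "\<dots> = real CARD('n) * (1 / k + 1 / information_centrality A s)"
    by (simp add: sum.distrib sum_resistance_distance algebra_simps)
  finally have "trace (grounded_inverse s k) = \<dots>" .
  moreover have "trace ((\<sigma>\<^sup>2 / 2) *\<^sub>R grounded_inverse s k) = \<sigma>\<^sup>2 / 2 * trace (grounded_inverse s k)"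
    by (simp add: trace_def sum_distrib_left)
  ultimately show ?thesis
    unfolding total_error_def
      steady_state_covariance_eq[OF positive_definite_drift_matrix[OF assms]
        drift_matrix_mult_grounded_inverse[OF assms]]
    by simp
qed

lemma tendsto_total_error:
  "((\<lambda>k. total_error A \<sigma> k {s}) \<longlongrightarrow>
     real CARD('n) * \<sigma>\<^sup>2 / 2 * (1 / information_centrality A s)) at_top"
proof -
  have "((\<lambda>k::real. 1 / k) \<longlongrightarrow> 0) at_top"
    by (rule tendsto_divide_0[OF tendsto_const filterlim_at_top_imp_at_infinity[OF filterlim_ident]])
  then have "((\<lambda>k. real CARD('n) * \<sigma>\<^sup>2 / 2 * (1 / k + 1 / information_centrality A s)) \<longlongrightarrow>
      real CARD('n) * \<sigma>\<^sup>2 / 2 * (0 + 1 / information_centrality A s)) at_top"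
    by (rule tendsto_mult[OF tendsto_const tendsto_add[OF _ tendsto_const]])
  moreover have "\<forall>\<^sub>F k in at_top. real CARD('n) * \<sigma>\<^sup>2 / 2 * (1 / k + 1 / information_centrality A s)
      = total_error A \<sigma> k {s}"
    using eventually_gt_at_top[of 0] by eventually_elim (simp add: total_error_single_leader)
  ultimately show ?thesis
    using Lim_transform_eventually by fastforce
qed

lemma noise_free_total_error_single_leader:
  "noise_free_total_error A \<sigma> {s} =
     real CARD('n) * \<sigma>\<^sup>2 / 2 * (1 / information_centrality A s)"
  unfolding noise_free_total_error_def
  by (rule tendsto_Lim[OF trivial_limit_at_top_linorder tendsto_total_error])

section \<open>Positivity of information centrality\<close>

lemma resistance_distance_self: "resistance_distance A i i = 0"
  by (simp add: resistance_distance_def Let_def)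

text \<open>
  With \<open>u = e\<^sub>i - e\<^sub>j\<close> and \<open>v = P u\<close>, the resistance distance is \<open>u \<bullet> P u = u \<bullet> P L P u = v \<bullet> L v \<ge> 0\<close>.
  If it were zero, then \<open>v\<close> would be constant and \<open>L v = 0\<close>; but \<open>L v = (I - J) u = u \<noteq> 0\<close>.
\<close>
lemma resistance_distance_pos:
  assumes "i \<noteq> j"
  shows "resistance_distance A i j > 0"
proof -
  let ?P = "pinv (laplacian A)"
  define u :: "real^'n" where "u = axis i 1 - axis j 1"
  define v where "v = ?P *v u"
  have Pu: "v $ l = ?P $ l $ i - ?P $ l $ j" for l
    unfolding v_def u_def matrix_vector_mult_diff_distrib matrix_vector_mult_basis column_def
    by simp
  have "resistance_distance A i j = u \<bullet> v"
    by (simp add: resistance_distance_def Let_def u_def inner_diff_left inner_axis' Pu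
        pinv_sym[of j i])
  also have "\<dots> = u \<bullet> (?P *v (laplacian A *v v))"
    using pinv_laplacian_pinv by (simp add: v_def matrix_vector_mul_assoc matrix_mul_assoc)
  also have "\<dots> = v \<bullet> (laplacian A *v v)"
    unfolding v_def by (metis dot_lmul_matrix transpose_matrix_vector transpose_pinv_laplacian)
  finally have form: "resistance_distance A i j = v \<bullet> (laplacian A *v v)" .
  have "v \<bullet> (laplacian A *v v) \<noteq> 0"
  proof
    assume zero: "v \<bullet> (laplacian A *v v) = 0"
    have "v $ l - v $ m = 0" for l m
      using laplacian_form_zero_imp_constant[OF zero, of l m] by simp
    then have "laplacian A *v v = 0"
      by (simp only: vec_eq_iff laplacian_mult_vec mult_zero_right sum.neutral_const zero_index simp_thms)
    moreover have "laplacian A *v v = u - averaging_matrix *v u"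
      by (simp add: v_def matrix_vector_mul_assoc laplacian_mult_pinv
          matrix_vector_mult_diff_rdistrib)
    moreover have "averaging_matrix *v u = 0"
      by (simp add: vec_eq_iff averaging_matrix_mult_vec u_def sum_subtractf axis_def)
    ultimately have "u $ i = 0"
      by simp
    with assms show False
      by (simp add: u_def axis_def)
  qed
  with form laplacian_nonneg[of v] show ?thesis
    by linarith
qed

lemma information_centrality_pos:
  assumes "CARD('n) \<ge> 2"
  shows "information_centrality A i > 0"
proof -
  have "UNIV \<noteq> {i}"
  proof
    assume "UNIV = {i}"
    then have "CARD('n) = card {i}"
      by (rule arg_cong)
    with assms show False
      by simp
  qed
  then obtain j where "i \<noteq> j"
    by (metis UNIV_eq_I singleton_iff)
  moreover have "resistance_distance A i l \<ge> 0" for l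
    using resistance_distance_pos[of i l] by (cases "i = l") (simp_all add: resistance_distance_self)
  ultimately have "(\<Sum>l\<in>UNIV. resistance_distance A i l) > 0"
    by (intro sum_pos2[of _ j] resistance_distance_pos) simp_all
  then show ?thesis
    by (simp add: information_centrality_def)
qed

end

section \<open>Optimal single leaders\<close>

text \<open>
  Positivity of \<open>c\<close> makes \<open>1 / c s\<close> strictly decreasing in \<open>c s\<close>; without it, the convention
  \<open>1 / 0 = 0\<close> would break the equivalence.
\<close>
lemma optimal_single_leader_iff:
  fixes c :: "'n::finite \<Rightarrow> real"
  assumes err: "\<And>s. err {s} = a * (b + 1 / c s)" and "a > 0" and c: "\<And>s. c s > 0"
  shows "optimal_leader_set err 1 S \<longleftrightarrow> (\<exists>s. S = {s} \<and> is_arg_max c (\<lambda>_. True) s)"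
proof -
  have less: "err {t} < err {s} \<longleftrightarrow> c s < c t" for s t
    using \<open>a > 0\<close> c[of s] c[of t] by (simp add: err field_simps)
  have "(\<forall>T. card T = 1 \<longrightarrow> \<not> err T < err {s}) \<longleftrightarrow> (\<forall>t. \<not> c s < c t)" for s
    by (auto simp: card_1_singleton_iff simp flip: less)
  then show ?thesis
    by (auto simp: optimal_leader_set_def is_arg_min_def is_arg_max_def card_1_singleton_iff)
qed

theorem corollary4:
  fixes E :: "('n::finite \<times> 'n) set"
    and A :: "real^'n^'n"
    and \<sigma> :: real
  assumes "CARD('n) \<ge> 2"
    and "undirected_weighted_graph E A"
    and "connected_graph E"
    and "\<sigma> > 0"
  shows "(\<forall>s k. k > 0 \<longrightarrow>
            total_error A \<sigma> k {s} =
              real CARD('n) * \<sigma>\<^sup>2 / 2 * (1 / k + 1 / information_centrality A s)) \<and>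
         (\<forall>s. ((\<lambda>k. total_error A \<sigma> k {s}) \<longlongrightarrow>
                 real CARD('n) * \<sigma>\<^sup>2 / 2 * (1 / information_centrality A s)) at_top \<and>
              noise_free_total_error A \<sigma> {s} =
                real CARD('n) * \<sigma>\<^sup>2 / 2 * (1 / information_centrality A s)) \<and>
         (\<forall>k S. k > 0 \<longrightarrow>
            (optimal_leader_set (total_error A \<sigma> k) 1 S \<longleftrightarrow>
              (\<exists>s. S = {s} \<and> is_arg_max (information_centrality A) (\<lambda>_. True) s))) \<and>
         (\<forall>S. optimal_leader_set (noise_free_total_error A \<sigma>) 1 S \<longleftrightarrow>
              (\<exists>s. S = {s} \<and> is_arg_max (information_centrality A) (\<lambda>_. True) s))"
proof -
  interpret connected_weighted_graph E A
    using assms(2,3) by unfold_locales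
  have scale: "real CARD('n) * \<sigma>\<^sup>2 / 2 > 0"
    using \<open>\<sigma> > 0\<close> by simp
  note pos = information_centrality_pos[OF assms(1)]
  have noisy: "optimal_leader_set (total_error A \<sigma> k) 1 S \<longleftrightarrow>
      (\<exists>s. S = {s} \<and> is_arg_max (information_centrality A) (\<lambda>_. True) s)" if "k > 0" for k S
    by (rule optimal_single_leader_iff, rule total_error_single_leader[OF that])
      (rule scale, rule pos)
  have noise_free: "optimal_leader_set (noise_free_total_error A \<sigma>) 1 S \<longleftrightarrow>
      (\<exists>s. S = {s} \<and> is_arg_max (information_centrality A) (\<lambda>_. True) s)" for S
    by (rule optimal_single_leader_iff[where b = 0])
      (unfold add_0, rule noise_free_total_error_single_leader, rule scale, rule pos)
  show ?thesis
    by (intro conjI allI impI total_error_single_leader tendsto_total_error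
        noise_free_total_error_single_leader noisy noise_free)
qed

end
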